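(* Let $H\in\mathcal D^\circ$ be additively separable. For $\tau\in\mathbb N=\{0,1,2,\dots\}$, a scenario $\omega$, and $\boldsymbol\mu=(\boldsymbol\mu_0,\dots,\boldsymbol\mu_\tau)$ with each $\boldsymbol\mu_t\in\mathbb R^L_+$, let $$I_H(\mathbf a,\omega,\tau;\boldsymbol\mu)=\sum_{t=0}^{\tau}\Big(R(\mathbf x_t,\mathbf a_t)+\beta\,\mathbb E[H(\mathbf x_{t+1})\mid\mathbf x_t,\mathbf a_t]-H(\mathbf x_t)+\boldsymbol\mu_t^\top[\mathbf b-\mathbf B(\mathbf x_t,\mathbf a_t)]\Big),\qquad I_H(\mathbf a,\omega,\tau)=I_H(\mathbf a,\omega,\tau;0),$$ $$\mathcal LH(\mathbf x_0)=H(\mathbf x_0)+\mathbb E\Big[\max_{\mathbf a\in\bar{\mathcal A}(\tau)}I_H(\mathbf a,\omega,\tau)\Big|\mathbf x_0\Big],\qquad \mathcal L^\circ H(\mathbf x_0)=H(\mathbf x_0)+\mathbb E\Big[\min_{\boldsymbol\mu\ge0}\max_{\mathbf a\in\mathcal A(\tau)}I_H(\mathbf a,\omega,\tau;\boldsymbol\mu)\Big|\mathbf x_0\Big].$$ Then: (a) $\mathcal LH(\mathbf x)\le\mathcal L^\circ H(\mathbf x)$ for all $\mathbf x\in\mathcal X$. (b) Suppose $H=J^{\boldsymbol\lambda}$ is the Lagrangian bound for some $\boldsymbol\lambda\ge0$ in $\mathbb R^L$. Then for every $\omega\in\Omega$ and $\tau\in\mathbb N$, $$\min_{\boldsymbol\mu\ge0}\max_{\mathbf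 a\in\mathcal A(\tau)}I_{J^{\boldsymbol\lambda}}(\mathbf a,\omega,\tau;\boldsymbol\mu)\le0.$$ Consequently, $\mathcal L^\circ J^{\boldsymbol\lambda}(\mathbf x)\le J^{\boldsymbol\lambda}(\mathbf x)$ for all $\mathbf x\in\mathcal X$.
   Context: Weakly coupled dynamic program. Fix integers $N,L\ge1$, a discount factor $\beta\in(0,1)$ and $\mathbf b\in\mathbb R^L$. For $n=1,\dots,N$, project $n$ has a state space $\mathcal X^n$, action sets $\mathcal A^n(x^n)$ for $x^n\in\mathcal X^n$, a controlled transition kernel $P_n(\cdot\mid x^n,a^n)$, a bounded reward $R^n(x^n,a^n)\in\mathbb R$, and a constraint function $\mathbf B^n(x^n,a^n)\in\mathbb R^L$. Put $\mathcal X=\prod_n\mathcal X^n$, $\mathcal A(\mathbf x)=\prod_n\mathcal A^n(x^n)$, $R(\mathbf x,\mathbf a)=\sum_nR^n(x^n,a^n)$, $\mathbf B(\mathbf x,\mathbf a)=\sum_n\mathbf B^n(x^n,a^n)$, and $\bar{\mathcal A}(\mathbf x)=\{\mathbf a\in\mathcal A(\mathbf x):\mathbf B(\mathbf x,\mathbf a)\le\mathbf b\}$ (componentwise), nonempty. The joint transition law is the product $P(\cdot\mid\mathbf x,\mathbf a)=\prod_nP_n(\cdot\mid x^n,a^n)$, and $\mathbb E[H(\mathbf x_{t+1})\mid\mathbf x_t,\mathbf a_t]$ denotes the integral of $H$ against $P(\cdot\mid\mathbf x_t,\mathbf a_t)$. Scenarios. On a probability space $(\Omega,\mathcal F,P)$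 the states are functions of the scenario $\omega$ and of the past controls: $\mathbf x_0=\mathbf x_0(\omega)$ and $\mathbf x_{t+1}=\mathbf x_{t+1}(\mathbf a(t),\omega)$ with $\mathbf a(t)=(\mathbf a_0,\dots,\mathbf a_t)$. Let $\mathcal F_0=\sigma\{\mathbf x_0\}$ and $\mathcal F_t=\sigma\{\mathbf x_0,\dots,\mathbf x_t,\mathbf a_0,\dots,\mathbf a_{t-1}\}$. $\mathbb A_{\mathbb F}$ is the set of policies selecting $\mathbf a_t\in\mathcal A(\mathbf x_t)$ with each $\mathbf a_t$ being $\mathcal F_t$-measurable (the linking constraint $\mathbf B\le\mathbf b$ not imposed); under such a policy the conditional law of $\mathbf x_{t+1}$ given $\mathcal F_t$ is $P(\cdot\mid\mathbf x_t,\mathbf a_t)$. Lagrangian bound. For $\boldsymbol\lambda\ge0$, $$J^{\boldsymbol\lambda}(\mathbf x_0)=\max_{\alpha\in\mathbb A_{\mathbb F}}\mathbb E\Big[\sum_{t=0}^\infty\beta^t\big(R(\mathbf x_t,\mathbf a_t)+\boldsymbol\lambda^\top[\mathbf b-\mathbf B(\mathbf x_t,\mathbf a_t)]\big)\Big|\mathbf x_0\Big].$$ The functions $R^n-\boldsymbol\lambda^\top\mathbf B^n$ are assumed bounded, so that $J^{\boldsymbol\lambda}$ is well defined and bounded. It is a known fact that $J^{\boldsymbol\lambda}(\mathbf x)=\frac{\boldsymbol\lambda^\top\mathbf b}{1-\beta}+\sum_{n=1}^NH^{\boldsymbol\lambda,n}(x^n)$, where $H^{\boldsymbol\lambda,n}$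 is the bounded solution of $H^{\boldsymbol\lambda,n}(x_0^n)=\max_{a_0^n\in\mathcal A^n(x_0^n)}\{R^n(x_0^n,a_0^n)-\boldsymbol\lambda^\top\mathbf B^n(x_0^n,a_0^n)+\beta\,\mathbb E[H^{\boldsymbol\lambda,n}(x_1^n)\mid x_0^n,a_0^n]\}$; in particular $J^{\boldsymbol\lambda}$ is additively separable. $\mathcal D^\circ$ is the set of additively separable functions $H(\mathbf x)=\theta+\sum_{n=1}^NH^n(x^n)$ with $\theta\in\mathbb R$ and $H^n:\mathcal X^n\to\mathbb R$ bounded and measurable. $\tau$ in the expectations is a random time with $P(\tau=t)=(1-\beta)\beta^t$, $t=0,1,\dots$, independent of $\{\mathcal F_t\}$ and of $\omega$. For $T\in\mathbb N$ and a scenario $\omega$, $\mathcal A(T)$ (resp. $\bar{\mathcal A}(T)$) is the set of $(\mathbf a_0,\dots,\mathbf a_T)$ with $\mathbf a_t\in\mathcal A(\mathbf x_t)$ (resp. $\mathbf a_t\in\bar{\mathcal A}(\mathbf x_t)$) along the trajectory $\mathbf x_t=\mathbf x_t(\mathbf a(t-1),\omega)$ they generate; optimizations are done for each fixed $(\omega,\tau)$, and the expectations are over both $\omega$ and $\tau$. Maxima and minima written are assumed to exist (otherwise read as suprema/infima) and to be measurable in $\omega$. *)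

theory Defs
  imports "HOL-Probability.Probability"
begin

text \<open>
  The projects are indexed by a finite type \<open>'n\<close> and the linking constraints by a finite type
  \<open>'l\<close>, so that \<open>N = CARD('n)\<close> and \<open>L = CARD('l)\<close>; the order on \<open>real ^ 'l\<close> is componentwise.
  All project state spaces (action spaces) are measurable spaces, possibly different ones, over a
  common ambient type \<open>'x\<close> (\<open>'a\<close>).

  \<open>traj D [a\<^sub>0, \<dots>, a\<^sub>t\<^sub>-\<^sub>1] \<omega>\<close> is the state at time \<open>t\<close> in scenario \<open>\<omega>\<close> after the controls
  \<open>a\<^sub>0, \<dots>, a\<^sub>t\<^sub>-\<^sub>1\<close>; in particular \<open>traj D []\<close> is the initial state as a random variable.
  \<open>given D x\<close> is the conditional law of the scenario given that the initial state is \<open>x\<close>.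
\<close>

record ('n, 'x, 'a, 'l, 'w) wcdp =
  disc :: real
  budget :: "real ^ ('l::finite)"
  St :: "'n \<Rightarrow> 'x measure"
  Ac :: "'n \<Rightarrow> 'a measure"
  feas :: "'n \<Rightarrow> 'x \<Rightarrow> 'a set"
  kern :: "'n \<Rightarrow> 'x \<Rightarrow> 'a \<Rightarrow> 'x measure"
  rew :: "'n \<Rightarrow> 'x \<Rightarrow> 'a \<Rightarrow> real"
  con :: "'n \<Rightarrow> 'x \<Rightarrow> 'a \<Rightarrow> real ^ 'l"
  scen :: "'w measure"
  traj :: "('n \<Rightarrow> 'a) list \<Rightarrow> 'w \<Rightarrow> ('n \<Rightarrow> 'x)"
  given :: "('n \<Rightarrow> 'x) \<Rightarrow> 'w measure"

definition states :: "('n::finite, 'x, 'a, 'l::finite, 'w) wcdp \<Rightarrow> ('n \<Rightarrow> 'x) measure" where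
  "states D = PiM UNIV (St D)"

definition controls :: "('n::finite, 'x, 'a, 'l::finite, 'w) wcdp \<Rightarrow> ('n \<Rightarrow> 'a) measure" where
  "controls D = PiM UNIV (Ac D)"

definition graph :: "('n::finite, 'x, 'a, 'l::finite, 'w) wcdp \<Rightarrow> 'n \<Rightarrow> ('x \<times> 'a) measure" where
  "graph D n = restrict_space (St D n \<Otimes>\<^sub>M Ac D n) {(x, a). a \<in> feas D n x}"

definition act :: "('n::finite, 'x, 'a, 'l::finite, 'w) wcdp \<Rightarrow> ('n \<Rightarrow> 'x) \<Rightarrow> ('n \<Rightarrow> 'a) set" where
  "act D x = (\<Pi> n\<in>UNIV. feas D n (x n))"

definition reward :: "('n::finite, 'x, 'a, 'l::finite, 'w) wcdp \<Rightarrow> ('n \<Rightarrow> 'x) \<Rightarrow> ('n \<Rightarrow> 'a) \<Rightarrow> real"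
  where "reward D x a = (\<Sum>n\<in>UNIV. rew D n (x n) (a n))"

definition linking ::
  "('n::finite, 'x, 'a, 'l::finite, 'w) wcdp \<Rightarrow> ('n \<Rightarrow> 'x) \<Rightarrow> ('n \<Rightarrow> 'a) \<Rightarrow> real ^ 'l"
  where "linking D x a = (\<Sum>n\<in>UNIV. con D n (x n) (a n))"

definition act_bar :: "('n::finite, 'x, 'a, 'l::finite, 'w) wcdp \<Rightarrow> ('n \<Rightarrow> 'x) \<Rightarrow> ('n \<Rightarrow> 'a) set"
  where "act_bar D x = {a \<in> act D x. linking D x a \<le> budget D}"

definition trans ::
  "('n::finite, 'x, 'a, 'l::finite, 'w) wcdp \<Rightarrow> ('n \<Rightarrow> 'x) \<Rightarrow> ('n \<Rightarrow> 'a) \<Rightarrow> ('n \<Rightarrow> 'x) measure"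
  where "trans D x a = PiM UNIV (\<lambda>n. kern D n (x n) (a n))"

text \<open>
  A policy is a sequence of random controls \<open>\<alpha> t \<omega>\<close>. Its information \<open>\<sigma>\<close>-algebra at time \<open>t\<close> is
  generated by the states up to \<open>t\<close> and the controls strictly before \<open>t\<close>.
\<close>

definition state_at ::
  "('n::finite, 'x, 'a, 'l::finite, 'w) wcdp \<Rightarrow> (nat \<Rightarrow> 'w \<Rightarrow> 'n \<Rightarrow> 'a) \<Rightarrow> nat \<Rightarrow> 'w \<Rightarrow> ('n \<Rightarrow> 'x)"
  where "state_at D \<alpha> t \<omega> = traj D (map (\<lambda>s. \<alpha> s \<omega>) [0..<t]) \<omega>"

definition info ::
  "('n::finite, 'x, 'a, 'l::finite, 'w) wcdp \<Rightarrow> (nat \<Rightarrow> 'w \<Rightarrow> 'n \<Rightarrow> 'a) \<Rightarrow> nat \<Rightarrow> 'w measure"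
  where "info D \<alpha> t = sigma (space (scen D))
    ({state_at D \<alpha> s -` E \<inter> space (scen D) | s E. s \<le> t \<and> E \<in> sets (states D)} \<union>
     {\<alpha> s -` C \<inter> space (scen D) | s C. s < t \<and> C \<in> sets (controls D)})"

definition policies ::
  "('n::finite, 'x, 'a, 'l::finite, 'w) wcdp \<Rightarrow> (nat \<Rightarrow> 'w \<Rightarrow> 'n \<Rightarrow> 'a) set"
  where "policies D = {\<alpha>. \<forall>t. \<alpha> t \<in> info D \<alpha> t \<rightarrow>\<^sub>M controls D \<and>
    (\<forall>\<omega>\<in>space (scen D). \<alpha> t \<omega> \<in> act D (state_at D \<alpha> t \<omega>))}"

definition paths ::
  "('n::finite, 'x, 'a, 'l::finite, 'w) wcdp \<Rightarrow> 'w \<Rightarrow> nat \<Rightarrow> ('n \<Rightarrow> 'a) list set"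
  where "paths D \<omega> T =
    {as. length as = Suc T \<and> (\<forall>t\<le>T. as ! t \<in> act D (traj D (take t as) \<omega>))}"

definition paths_bar ::
  "('n::finite, 'x, 'a, 'l::finite, 'w) wcdp \<Rightarrow> 'w \<Rightarrow> nat \<Rightarrow> ('n \<Rightarrow> 'a) list set"
  where "paths_bar D \<omega> T =
    {as. length as = Suc T \<and> (\<forall>t\<le>T. as ! t \<in> act_bar D (traj D (take t as) \<omega>))}"

definition weakly_coupled :: "('n::finite, 'x, 'a, 'l::finite, 'w) wcdp \<Rightarrow> bool" where
  "weakly_coupled D \<longleftrightarrow>
    0 < disc D \<and> disc D < 1 \<and>
    (\<forall>n. \<forall>x\<in>space (St D n). feas D n x \<subseteq> space (Ac D n)) \<and>
    (\<forall>x\<in>space (states D). act_bar D x \<noteq> {}) \<and>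
    (\<forall>n. (\<lambda>(x, a). kern D n x a) \<in> graph D n \<rightarrow>\<^sub>M prob_algebra (St D n)) \<and>
    (\<forall>n. (\<lambda>(x, a). rew D n x a) \<in> borel_measurable (graph D n)) \<and>
    (\<forall>n. bounded ((\<lambda>(x, a). rew D n x a) ` space (graph D n))) \<and>
    (\<forall>n. (\<lambda>(x, a). con D n x a) \<in> borel_measurable (graph D n))"

text \<open>
  The first line makes \<open>given D\<close> a regular conditional probability of \<open>scen D\<close> given the initial
  state; it is concentrated on the scenarios starting in \<open>x\<close>, and it fixes the meaning of
  \<open>E[\<dots> | x\<^sub>0 = x]\<close> for every single state \<open>x\<close> rather than for almost every one.
  The last clause says that, under each policy, \<open>trans D x\<^sub>t a\<^sub>t\<close> is the conditional law of the
  next state given the information at time \<open>t\<close>.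
\<close>

definition scenario_model :: "('n::finite, 'x, 'a, 'l::finite, 'w) wcdp \<Rightarrow> bool" where
  "scenario_model D \<longleftrightarrow>
    (prob_space (scen D) \<and>
     traj D [] \<in> scen D \<rightarrow>\<^sub>M states D \<and>
     given D \<in> states D \<rightarrow>\<^sub>M prob_algebra (scen D) \<and>
     scen D = bind (distr (scen D) (states D) (traj D [])) (given D) \<and>
     (\<forall>x\<in>space (states D). distr (given D x) (states D) (traj D []) = return (states D) x)) \<and>
    (\<forall>\<omega>\<in>space (scen D). \<forall>as.
       (\<forall>t<length as. as ! t \<in> act D (traj D (take t as) \<omega>)) \<longrightarrow> traj D as \<omega> \<in> space (states D)) \<and>
    (\<forall>\<alpha>\<in>policies D. \<forall>t. state_at D \<alpha> t \<in> scen D \<rightarrow>\<^sub>M states D) \<and>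
    (\<forall>\<alpha>\<in>policies D. \<forall>t. \<forall>x\<in>space (states D). \<forall>E\<in>sets (states D).
       AE \<omega> in given D x.
         real_cond_exp (given D x) (info D \<alpha> t) (\<lambda>\<omega>'. indicator E (state_at D \<alpha> (Suc t) \<omega>')) \<omega>
         = measure (trans D (state_at D \<alpha> t \<omega>) (\<alpha> t \<omega>)) E)"

definition lagrangian_bound ::
  "('n::finite, 'x, 'a, 'l::finite, 'w) wcdp \<Rightarrow> real ^ 'l \<Rightarrow> ('n \<Rightarrow> 'x) \<Rightarrow> real"
  where "lagrangian_bound D l x =
    (SUP \<alpha>\<in>policies D. \<integral>\<omega>. (\<Sum>t. disc D ^ t *
        (reward D (state_at D \<alpha> t \<omega>) (\<alpha> t \<omega>)
         + l \<bullet> (budget D - linking D (state_at D \<alpha> t \<omega>) (\<alpha> t \<omega>)))) \<partial>given D x)"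

definition bounded_bellman_solution ::
  "('n::finite, 'x, 'a, 'l::finite, 'w) wcdp \<Rightarrow> real ^ 'l \<Rightarrow> 'n \<Rightarrow> ('x \<Rightarrow> real) \<Rightarrow> bool"
  where "bounded_bellman_solution D l n h \<longleftrightarrow>
    h \<in> borel_measurable (St D n) \<and> bounded (h ` space (St D n)) \<and>
    (\<forall>x\<in>space (St D n). h x =
       (SUP a\<in>feas D n x. rew D n x a - l \<bullet> con D n x a
          + disc D * (\<integral>y. h y \<partial>kern D n x a)))"

definition separable ::
  "('n::finite, 'x, 'a, 'l::finite, 'w) wcdp \<Rightarrow> (('n \<Rightarrow> 'x) \<Rightarrow> real) set"
  where "separable D = {H. \<exists>\<theta> h.
    (\<forall>n. h n \<in> borel_measurable (St D n) \<and> bounded (h n ` space (St D n))) \<and>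
    (\<forall>x\<in>space (states D). H x = \<theta> + (\<Sum>n\<in>UNIV. h n (x n)))}"

definition info_value ::
  "('n::finite, 'x, 'a, 'l::finite, 'w) wcdp \<Rightarrow> (('n \<Rightarrow> 'x) \<Rightarrow> real) \<Rightarrow>
   ('n \<Rightarrow> 'a) list \<Rightarrow> 'w \<Rightarrow> nat \<Rightarrow> (nat \<Rightarrow> real ^ 'l) \<Rightarrow> real"
  where "info_value D H as \<omega> \<tau> \<mu> = (\<Sum>t\<le>\<tau>.
    let x = traj D (take t as) \<omega>; a = as ! t in
      reward D x a + disc D * (\<integral>y. H y \<partial>trans D x a) - H x + \<mu> t \<bullet> (budget D - linking D x a))"

text \<open>
  Maxima and minima are read as suprema and infima in the extended reals, since the supremum over
  all unlinked paths can be \<open>\<infinity>\<close> for some multipliers when the constraint functions are unbounded.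
\<close>

definition max_feasible ::
  "('n::finite, 'x, 'a, 'l::finite, 'w) wcdp \<Rightarrow> (('n \<Rightarrow> 'x) \<Rightarrow> real) \<Rightarrow> 'w \<Rightarrow> nat \<Rightarrow> ereal"
  where "max_feasible D H \<omega> \<tau> =
    (SUP as\<in>paths_bar D \<omega> \<tau>. ereal (info_value D H as \<omega> \<tau> (\<lambda>_. 0)))"

definition min_max ::
  "('n::finite, 'x, 'a, 'l::finite, 'w) wcdp \<Rightarrow> (('n \<Rightarrow> 'x) \<Rightarrow> real) \<Rightarrow> 'w \<Rightarrow> nat \<Rightarrow> ereal"
  where "min_max D H \<omega> \<tau> =
    (INF \<mu>\<in>{\<mu>. \<forall>t\<le>\<tau>. 0 \<le> \<mu> t}. SUP as\<in>paths D \<omega> \<tau>. ereal (info_value D H as \<omega> \<tau> \<mu>))"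

text \<open>
  The random time is independent of the scenario, whence the product measure;
  \<open>geometric_pmf (1 - \<beta>)\<close> has mass \<open>(1 - \<beta>) * \<beta> ^ t\<close> at \<open>t\<close>. For bounded \<open>H\<close> the two extremal
  values above are bounded in absolute value by a constant times \<open>\<tau> + 1\<close>: the first because the
  rewards are bounded, the second because it lies between the first and its inner supremum at
  \<open>\<mu> = 0\<close>. So \<open>real_of_ereal\<close> loses nothing and the integrals are finite.
\<close>

definition joint ::
  "('n::finite, 'x, 'a, 'l::finite, 'w) wcdp \<Rightarrow> ('n \<Rightarrow> 'x) \<Rightarrow> ('w \<times> nat) measure"
  where "joint D x = given D x \<Otimes>\<^sub>M measure_pmf (geometric_pmf (1 - disc D))"

definition L_op ::
  "('n::finite, 'x, 'a, 'l::finite, 'w) wcdp \<Rightarrow> (('n \<Rightarrow> 'x) \<Rightarrow> real) \<Rightarrow> ('n \<Rightarrow> 'x) \<Rightarrow> real"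
  where "L_op D H x = H x + (\<integral>(\<omega>, \<tau>). real_of_ereal (max_feasible D H \<omega> \<tau>) \<partial>joint D x)"

definition L_circ_op ::
  "('n::finite, 'x, 'a, 'l::finite, 'w) wcdp \<Rightarrow> (('n \<Rightarrow> 'x) \<Rightarrow> real) \<Rightarrow> ('n \<Rightarrow> 'x) \<Rightarrow> real"
  where "L_circ_op D H x = H x + (\<integral>(\<omega>, \<tau>). real_of_ereal (min_max D H \<omega> \<tau>) \<partial>joint D x)"

end

theory Submission
  imports Defs
begin

text \<open>
  Part (a) is weak duality, scenario by scenario. Along a path that respects the linking
  constraint the slack \<open>b - B\<close> is nonnegative, so a penalty with nonnegative multipliers only
  raises the value of the path, and dropping the linking constraint enlarges the set of paths.
  This gives the inequality between the two extremal values in the extended reals; to integrate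
  it one needs both values to be finite and integrable. They are of order \<open>\<tau> + 1\<close>: every
  summand of the information value at \<open>\<mu> = 0\<close> is bounded uniformly on feasible pairs, linked paths
  exist because linked actions do, and \<open>\<tau>\<close> is geometric, hence has a finite mean.

  Part (b) takes the constant multiplier \<open>\<mu>\<^sub>t = l\<close>. Since the Lagrangian bound is separable, its
  expected value after one step is the sum of the expected values of the projects, and the summand at
  time \<open>t\<close> splits into \<open>N\<close> Bellman residuals, one per project, with the budget terms cancelling
  because \<open>1 + \<beta> / (1 - \<beta>) = 1 / (1 - \<beta>)\<close>. A Bellman residual is never positive, whatever
  action is taken. Hence every path has a nonpositive value in every scenario,
  even though the controls may anticipate the future, and averaging over scenarios and over \<open>\<tau>\<close>
  preserves the sign.
\<close>

section \<open>Feasible states and actions\<close>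

lemma states_component:
  "x \<in> space (states D) \<Longrightarrow> x n \<in> space (St D n)"
  by (auto simp: states_def space_PiM)

lemma mem_space_graph:
  assumes "weakly_coupled D" "x \<in> space (St D n)" "a \<in> feas D n x"
  shows "(x, a) \<in> space (graph D n)"
  using assms by (auto simp: weakly_coupled_def graph_def space_restrict_space space_pair_measure)

lemma act_component: "a \<in> act D x \<Longrightarrow> a n \<in> feas D n (x n)"
  by (auto simp: act_def)

lemma kern_prob_algebra:
  assumes "weakly_coupled D" "x \<in> space (St D n)" "a \<in> feas D n x"
  shows "kern D n x a \<in> space (prob_algebra (St D n))"
proof -
  have "(\<lambda>(x, a). kern D n x a) \<in> graph D n \<rightarrow>\<^sub>M prob_algebra (St D n)"
    using assms(1) by (auto simp: weakly_coupled_def)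
  from measurable_space[OF this mem_space_graph[OF assms]] show ?thesis
    by simp
qed

lemma prob_space_kern:
  assumes "weakly_coupled D" "x \<in> space (St D n)" "a \<in> feas D n x"
  shows "prob_space (kern D n x a)"
  using kern_prob_algebra[OF assms] by (simp add: space_prob_algebra)

lemma sets_kern:
  assumes "weakly_coupled D" "x \<in> space (St D n)" "a \<in> feas D n x"
  shows "sets (kern D n x a) = sets (St D n)"
  using kern_prob_algebra[OF assms] by (simp add: space_prob_algebra)

lemma prob_space_trans:
  assumes "weakly_coupled D" "x \<in> space (states D)" "a \<in> act D x"
  shows "prob_space (trans D x a)"
  unfolding trans_def
  by (intro prob_space_PiM prob_space_kern assms states_component act_component)

lemma sets_trans:
  assumes "weakly_coupled D" "x \<in> space (states D)" "a \<in> act D x"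
  shows "sets (trans D x a) = sets (states D)"
  unfolding trans_def states_def
  by (intro sets_PiM_cong refl sets_kern assms states_component act_component)

text \<open>A state reached at time \<open>t\<close> depends only on the first \<open>t\<close> controls of the path, so the
  closure property of the scenario model applies to that prefix.\<close>

lemma paths_state:
  assumes "scenario_model D" "\<omega> \<in> space (scen D)" "as \<in> paths D \<omega> \<tau>" "t \<le> \<tau>"
  shows "traj D (take t as) \<omega> \<in> space (states D)"
proof -
  have "\<forall>s<length (take t as). take t as ! s \<in> act D (traj D (take s (take t as)) \<omega>)"
    using assms(3,4) by (auto simp: paths_def min_def)
  with assms(1,2) show ?thesis unfolding scenario_model_def by blast
qed

lemma paths_act:
  "as \<in> paths D \<omega> \<tau> \<Longrightarrow> t \<le> \<tau> \<Longrightarrow> as ! t \<in> act D (traj D (take t as) \<omega>)"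
  by (simp add: paths_def)

lemma paths_bar_subset_paths: "paths_bar D \<omega> \<tau> \<subseteq> paths D \<omega> \<tau>"
  by (auto simp: paths_bar_def paths_def act_bar_def)

text \<open>Linked paths are built greedily: after any linked prefix the state is a genuine one, so
  a linked action is available there.\<close>

lemma paths_bar_nonempty:
  assumes wc: "weakly_coupled D" and sm: "scenario_model D" and \<omega>: "\<omega> \<in> space (scen D)"
  shows "paths_bar D \<omega> \<tau> \<noteq> {}"
proof -
  have "\<exists>as. length as = k \<and> (\<forall>t<k. as ! t \<in> act_bar D (traj D (take t as) \<omega>))" for k
  proof (induction k)
    case 0
    show ?case by simp
  next
    case (Suc k)
    then obtain as where len: "length as = k"
      and as: "\<And>t. t < k \<Longrightarrow> as ! t \<in> act_bar D (traj D (take t as) \<omega>)"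
      by blast
    have "\<forall>t<length as. as ! t \<in> act D (traj D (take t as) \<omega>)"
      using as len by (auto simp: act_bar_def)
    with sm \<omega> have "traj D as \<omega> \<in> space (states D)"
      unfolding scenario_model_def by blast
    with wc obtain a where a: "a \<in> act_bar D (traj D as \<omega>)"
      unfolding weakly_coupled_def by blast
    have "(as @ [a]) ! t \<in> act_bar D (traj D (take t (as @ [a])) \<omega>)" if "t < Suc k" for t
      using as[of t] a that len by (cases "t < k") (auto simp: nth_append less_Suc_eq)
    with len show ?case by (intro exI[of _ "as @ [a]"]) simp
  qed
  from this[of "Suc \<tau>"] show ?thesis
    by (auto simp: paths_bar_def less_Suc_eq_le)
qed

section \<open>Expectations of bounded and of separable functions\<close>

text \<open>If \<open>f\<close> is not integrable, its integral is \<open>0\<close> by convention, and \<open>0 \<le> K\<close> because a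
  probability space has a point.\<close>

lemma (in prob_space) abs_expectation_le:
  fixes f :: "'a \<Rightarrow> real"
  assumes "\<And>x. x \<in> space M \<Longrightarrow> \<bar>f x\<bar> \<le> K"
  shows "\<bar>\<integral>x. f x \<partial>M\<bar> \<le> K"
proof (cases "integrable M f")
  case True
  have "\<bar>\<integral>x. f x \<partial>M\<bar> \<le> (\<integral>x. \<bar>f x\<bar> \<partial>M)"
    by (rule integral_abs_bound)
  also have "\<dots> \<le> K"
    using True assms by (intro integral_le_const) auto
  finally show ?thesis .
next
  case False
  obtain x where "x \<in> space M" using not_empty by auto
  from assms[OF this] have "0 \<le> K" by linarith
  with False show ?thesis by (simp add: not_integrable_integral_eq)
qed

text \<open>The coordinate laws of the product kernel are the project kernels, so an additively
  separable function is averaged project by project.\<close>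

lemma expectation_separable:
  fixes h :: "'n::finite \<Rightarrow> 'x \<Rightarrow> real" and D :: "('n, 'x, 'a, 'l::finite, 'w) wcdp"
  assumes wc: "weakly_coupled D" and x: "x \<in> space (states D)" and a: "a \<in> act D x"
    and h: "\<And>n. h n \<in> borel_measurable (St D n)" "\<And>n. bounded (h n ` space (St D n))"
    and H: "\<And>y. y \<in> space (states D) \<Longrightarrow> H y = \<theta> + (\<Sum>n\<in>UNIV. h n (y n))"
  shows "(\<integral>y. H y \<partial>trans D x a) = \<theta> + (\<Sum>n\<in>UNIV. \<integral>z. h n z \<partial>kern D n (x n) (a n))"
proof -
  let ?T = "trans D x a" and ?K = "\<lambda>n. kern D n (x n) (a n)"
  interpret T: prob_space ?T by (rule prob_space_trans[OF wc x a])
  have kern: "prob_space (?K n)" "sets (?K n) = sets (St D n)" for n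
    using prob_space_kern[OF wc states_component[OF x] act_component[OF a]]
      sets_kern[OF wc states_component[OF x] act_component[OF a]] by auto
  have spaceT: "space ?T = space (states D)"
    by (rule sets_eq_imp_space_eq[OF sets_trans[OF wc x a]])
  have distr: "distr ?T (?K n) (\<lambda>y. y n) = ?K n" for n
    unfolding trans_def by (rule distr_PiM_component) (auto intro: kern)
  have comp: "(\<lambda>y. y n) \<in> ?T \<rightarrow>\<^sub>M ?K n" for n
    unfolding trans_def by (rule measurable_component_singleton) simp
  have meas: "h n \<in> borel_measurable (?K n)" for n
    using h(1)[of n] measurable_cong_sets[OF kern(2)[of n] refl] by blast
  have int: "integrable ?T (\<lambda>y. h n (y n))" for n
  proof -
    obtain B where "\<And>z. z \<in> space (St D n) \<Longrightarrow> \<bar>h n z\<bar> \<le> B"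
      using h(2)[of n] by (auto simp: bounded_iff)
    then show ?thesis
      using measurable_compose[OF comp meas] spaceT
      by (intro T.integrable_const_bound[of _ B] AE_I2) (auto intro: states_component)
  qed
  have marginal: "(\<integral>y. h n (y n) \<partial>?T) = (\<integral>z. h n z \<partial>?K n)" for n
    using integral_distr[OF comp meas, of n] distr[of n] by simp
  have "(\<integral>y. H y \<partial>?T) = (\<integral>y. \<theta> + (\<Sum>n\<in>UNIV. h n (y n)) \<partial>?T)"
    by (rule Bochner_Integration.integral_cong) (auto simp: spaceT H)
  also have "\<dots> = \<theta> + (\<Sum>n\<in>UNIV. \<integral>y. h n (y n) \<partial>?T)"
    using int by (simp add: T.prob_space)
  finally show ?thesis by (simp only: marginal)
qed

section \<open>Weak duality\<close>

lemma inner_nonneg_vec: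
  fixes u v :: "real ^ 'l::finite"
  assumes "0 \<le> u" "0 \<le> v"
  shows "0 \<le> u \<bullet> v"
  using assms by (auto simp: inner_vec_def less_eq_vec_def intro!: sum_nonneg)

lemma info_value_mono_multiplier:
  assumes "as \<in> paths_bar D \<omega> \<tau>" "\<And>t. t \<le> \<tau> \<Longrightarrow> 0 \<le> \<mu> t"
  shows "info_value D H as \<omega> \<tau> (\<lambda>_. 0) \<le> info_value D H as \<omega> \<tau> \<mu>"
  unfolding info_value_def Let_def
proof (rule sum_mono)
  fix t assume t: "t \<in> {..\<tau>}"
  have "linking D (traj D (take t as) \<omega>) (as ! t) \<le> budget D"
    using assms(1) t by (auto simp: paths_bar_def act_bar_def)
  then have "0 \<le> \<mu> t \<bullet> (budget D - linking D (traj D (take t as) \<omega>) (as ! t))"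
    using assms(2)[of t] t by (intro inner_nonneg_vec) (auto simp: less_eq_vec_def)
  then show "reward D (traj D (take t as) \<omega>) (as ! t)
       + disc D * (\<integral>y. H y \<partial>trans D (traj D (take t as) \<omega>) (as ! t)) - H (traj D (take t as) \<omega>)
       + 0 \<bullet> (budget D - linking D (traj D (take t as) \<omega>) (as ! t))
     \<le> reward D (traj D (take t as) \<omega>) (as ! t)
       + disc D * (\<integral>y. H y \<partial>trans D (traj D (take t as) \<omega>) (as ! t)) - H (traj D (take t as) \<omega>)
       + \<mu> t \<bullet> (budget D - linking D (traj D (take t as) \<omega>) (as ! t))"
    by simp
qed

lemma max_feasible_le_min_max:
  fixes D :: "('n::finite, 'x, 'a, 'l::finite, 'w) wcdp"
  shows "max_feasible D H \<omega> \<tau> \<le> min_max D H \<omega> \<tau>"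
  unfolding max_feasible_def min_max_def
proof (intro INF_greatest SUP_mono)
  fix \<mu> :: "nat \<Rightarrow> real ^ 'l" and as
  assume "\<mu> \<in> {\<mu>. \<forall>t\<le>\<tau>. 0 \<le> \<mu> t}" and as: "as \<in> paths_bar D \<omega> \<tau>"
  then have "info_value D H as \<omega> \<tau> (\<lambda>_. 0) \<le> info_value D H as \<omega> \<tau> \<mu>"
    by (intro info_value_mono_multiplier) auto
  with as show "\<exists>as'\<in>paths D \<omega> \<tau>.
      ereal (info_value D H as \<omega> \<tau> (\<lambda>_. 0)) \<le> ereal (info_value D H as' \<omega> \<tau> \<mu>)"
    using paths_bar_subset_paths by fastforce
qed

section \<open>Finiteness and integrability\<close>

lemma separable_bounded:
  assumes "H \<in> separable D"
  obtains K where "\<And>x. x \<in> space (states D) \<Longrightarrow> \<bar>H x\<bar> \<le> K"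
proof -
  from assms obtain \<theta> h where h: "\<And>n. bounded (h n ` space (St D n))"
    and H: "\<And>x. x \<in> space (states D) \<Longrightarrow> H x = \<theta> + (\<Sum>n\<in>UNIV. h n (x n))"
    unfolding separable_def by blast
  from h have "\<forall>n. \<exists>B. \<forall>z\<in>space (St D n). \<bar>h n z\<bar> \<le> B"
    by (simp add: bounded_iff)
  then obtain B where B: "\<And>n z. z \<in> space (St D n) \<Longrightarrow> \<bar>h n z\<bar> \<le> B n"
    by metis
  show ?thesis
  proof (rule that)
    fix x assume x: "x \<in> space (states D)"
    have "\<bar>H x\<bar> \<le> \<bar>\<theta>\<bar> + \<bar>\<Sum>n\<in>UNIV. h n (x n)\<bar>"
      unfolding H[OF x] by (rule abs_triangle_ineq)
    also have "\<bar>\<Sum>n\<in>UNIV. h n (x n)\<bar> \<le> (\<Sum>n\<in>UNIV. B n)"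
      by (rule order_trans[OF sum_abs sum_mono]) (rule B[OF states_component[OF x]])
    finally show "\<bar>H x\<bar> \<le> \<bar>\<theta>\<bar> + (\<Sum>n\<in>UNIV. B n)" by simp
  qed
qed

lemma reward_bounded:
  assumes wc: "weakly_coupled D"
  obtains C where "\<And>x a. x \<in> space (states D) \<Longrightarrow> a \<in> act D x \<Longrightarrow> \<bar>reward D x a\<bar> \<le> C"
proof -
  have "\<forall>n. \<exists>B. \<forall>(x, a)\<in>space (graph D n). \<bar>rew D n x a\<bar> \<le> B"
    using wc unfolding weakly_coupled_def bounded_iff by (simp add: case_prod_beta)
  then obtain B where B: "\<And>n x a. (x, a) \<in> space (graph D n) \<Longrightarrow> \<bar>rew D n x a\<bar> \<le> B n"
    by (metis case_prodD)
  show ?thesis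
  proof (rule that)
    fix x a assume x: "x \<in> space (states D)" and a: "a \<in> act D x"
    show "\<bar>reward D x a\<bar> \<le> (\<Sum>n\<in>UNIV. B n)"
      unfolding reward_def
      by (rule order_trans[OF sum_abs sum_mono])
        (rule B[OF mem_space_graph[OF wc states_component[OF x] act_component[OF a]]])
  qed
qed

lemma info_value_bounded:
  assumes wc: "weakly_coupled D" and sm: "scenario_model D" and H: "H \<in> separable D"
  obtains C where "\<And>\<omega> \<tau> as. \<omega> \<in> space (scen D) \<Longrightarrow> as \<in> paths D \<omega> \<tau> \<Longrightarrow>
    \<bar>info_value D H as \<omega> \<tau> (\<lambda>_. 0)\<bar> \<le> C * real (Suc \<tau>)"
proof -
  obtain K where K: "\<And>x. x \<in> space (states D) \<Longrightarrow> \<bar>H x\<bar> \<le> K"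
    using separable_bounded[OF H] by blast
  obtain C where C: "\<And>x a. x \<in> space (states D) \<Longrightarrow> a \<in> act D x \<Longrightarrow> \<bar>reward D x a\<bar> \<le> C"
    using reward_bounded[OF wc] by blast
  have \<beta>: "0 < disc D" "disc D < 1" using wc by (auto simp: weakly_coupled_def)
  show ?thesis
  proof (rule that)
    fix \<omega> \<tau> as assume \<omega>: "\<omega> \<in> space (scen D)" and as: "as \<in> paths D \<omega> \<tau>"
    have "\<bar>info_value D H as \<omega> \<tau> (\<lambda>_. 0)\<bar> \<le> (\<Sum>t\<le>\<tau>. C + 2 * K)"
      unfolding info_value_def Let_def
    proof (rule order_trans[OF sum_abs sum_mono])
      fix t assume "t \<in> {..\<tau>}"
      then have t: "t \<le> \<tau>" by simp
      let ?x = "traj D (take t as) \<omega>" and ?a = "as ! t"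
      have x: "?x \<in> space (states D)" by (rule paths_state[OF sm \<omega> as t])
      have a: "?a \<in> act D ?x" by (rule paths_act[OF as t])
      interpret T: prob_space "trans D ?x ?a" by (rule prob_space_trans[OF wc x a])
      have E: "\<bar>\<integral>y. H y \<partial>trans D ?x ?a\<bar> \<le> K"
        by (rule T.abs_expectation_le)
          (use K sets_eq_imp_space_eq[OF sets_trans[OF wc x a]] in auto)
      have "\<bar>disc D * (\<integral>y. H y \<partial>trans D ?x ?a)\<bar> \<le> 1 * K"
        unfolding abs_mult using \<beta> E by (intro mult_mono) auto
      then show "\<bar>reward D ?x ?a + disc D * (\<integral>y. H y \<partial>trans D ?x ?a) - H ?x
          + 0 \<bullet> (budget D - linking D ?x ?a)\<bar> \<le> C + 2 * K"
        using C[OF x a] K[OF x] by (simp add: abs_le_iff)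
    qed
    also have "\<dots> = (C + 2 * K) * real (Suc \<tau>)" by (simp add: mult.commute)
    finally show "\<bar>info_value D H as \<omega> \<tau> (\<lambda>_. 0)\<bar> \<le> (C + 2 * K) * real (Suc \<tau>)" .
  qed
qed

text \<open>The lower bound needs a linked path and the upper bound the particular multiplier \<open>0\<close>;
  weak duality carries the lower bound to the larger value and the upper bound to the smaller
  one.\<close>

lemma extremal_values_bounded:
  assumes wc: "weakly_coupled D" and sm: "scenario_model D" and H: "H \<in> separable D"
  obtains C where
    "\<And>\<omega> \<tau>. \<omega> \<in> space (scen D) \<Longrightarrow> \<bar>max_feasible D H \<omega> \<tau>\<bar> \<le> ereal (C * real (Suc \<tau>))"
    "\<And>\<omega> \<tau>. \<omega> \<in> space (scen D) \<Longrightarrow> \<bar>min_max D H \<omega> \<tau>\<bar> \<le> ereal (C * real (Suc \<tau>))"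
proof -
  obtain C where C: "\<And>\<omega> \<tau> as. \<omega> \<in> space (scen D) \<Longrightarrow> as \<in> paths D \<omega> \<tau> \<Longrightarrow>
      \<bar>info_value D H as \<omega> \<tau> (\<lambda>_. 0)\<bar> \<le> C * real (Suc \<tau>)"
    using info_value_bounded[OF assms] by blast
  have lower: "ereal (- (C * real (Suc \<tau>))) \<le> max_feasible D H \<omega> \<tau>"
    if \<omega>: "\<omega> \<in> space (scen D)" for \<omega> \<tau>
  proof -
    obtain as where as: "as \<in> paths_bar D \<omega> \<tau>"
      using paths_bar_nonempty[OF wc sm \<omega>] by blast
    have "\<bar>info_value D H as \<omega> \<tau> (\<lambda>_. 0)\<bar> \<le> C * real (Suc \<tau>)"
      by (rule C[OF \<omega> subsetD[OF paths_bar_subset_paths as]])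
    then have "ereal (- (C * real (Suc \<tau>))) \<le> ereal (info_value D H as \<omega> \<tau> (\<lambda>_. 0))"
      by (simp only: ereal_less_eq)
    also have "\<dots> \<le> max_feasible D H \<omega> \<tau>"
      unfolding max_feasible_def using as by (rule SUP_upper)
    finally show ?thesis .
  qed
  have upper: "min_max D H \<omega> \<tau> \<le> ereal (C * real (Suc \<tau>))"
    if \<omega>: "\<omega> \<in> space (scen D)" for \<omega> \<tau>
  proof -
    have "min_max D H \<omega> \<tau> \<le> (SUP as\<in>paths D \<omega> \<tau>. ereal (info_value D H as \<omega> \<tau> (\<lambda>_. 0)))"
      unfolding min_max_def by (rule INF_lower) simp
    also have "\<dots> \<le> ereal (C * real (Suc \<tau>))"
    proof (rule SUP_least)
      fix as assume "as \<in> paths D \<omega> \<tau>"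
      from C[OF \<omega> this]
      show "ereal (info_value D H as \<omega> \<tau> (\<lambda>_. 0)) \<le> ereal (C * real (Suc \<tau>))"
        by (simp only: ereal_less_eq)
    qed
    finally show ?thesis .
  qed
  have abs_le: "\<bar>e\<bar> \<le> ereal c" if "ereal (- c) \<le> e" "e \<le> ereal c" for e c
    using that by (cases e) auto
  show ?thesis
  proof (rule that)
    fix \<omega> \<tau> assume \<omega>: "\<omega> \<in> space (scen D)"
    note bounds = lower[OF \<omega>, of \<tau>] upper[OF \<omega>, of \<tau>] max_feasible_le_min_max[of D H \<omega> \<tau>]
    show "\<bar>max_feasible D H \<omega> \<tau>\<bar> \<le> ereal (C * real (Suc \<tau>))"
      by (rule abs_le[OF bounds(1) order_trans[OF bounds(3,2)]])
    show "\<bar>min_max D H \<omega> \<tau>\<bar> \<le> ereal (C * real (Suc \<tau>))"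
      by (rule abs_le[OF order_trans[OF bounds(1,3)] bounds(2)])
  qed
qed

lemma given_prob_algebra:
  assumes "scenario_model D" "x \<in> space (states D)"
  shows "given D x \<in> space (prob_algebra (scen D))"
proof -
  have "given D \<in> states D \<rightarrow>\<^sub>M prob_algebra (scen D)"
    using assms(1) by (simp add: scenario_model_def)
  then show ?thesis using assms(2) by (rule measurable_space)
qed

lemma space_given:
  assumes "scenario_model D" "x \<in> space (states D)"
  shows "space (given D x) = space (scen D)"
  using given_prob_algebra[OF assms] by (auto simp: space_prob_algebra dest: sets_eq_imp_space_eq)

lemma space_joint:
  assumes "scenario_model D" "x \<in> space (states D)"
  shows "space (joint D x) = space (scen D) \<times> UNIV"
  by (simp add: joint_def space_pair_measure space_given[OF assms])

text \<open>Linear growth in \<open>\<tau>\<close> suffices because the geometric law has a finite mean, and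
  measurability for each \<open>\<tau>\<close> suffices because \<open>\<tau>\<close> ranges over a countable set.\<close>

lemma integrable_joint_linear_growth:
  fixes f :: "'w \<Rightarrow> nat \<Rightarrow> ereal"
    and D :: "('n::finite, 'x, 'a, 'l::finite, 'w) wcdp"
  assumes wc: "weakly_coupled D" and sm: "scenario_model D" and x: "x \<in> space (states D)"
    and meas: "\<And>\<tau>. (\<lambda>\<omega>. f \<omega> \<tau>) \<in> borel_measurable (scen D)"
    and bound: "\<And>\<omega> \<tau>. \<omega> \<in> space (scen D) \<Longrightarrow> \<bar>f \<omega> \<tau>\<bar> \<le> ereal (C * real (Suc \<tau>))"
  shows "integrable (joint D x) (\<lambda>(\<omega>, \<tau>). real_of_ereal (f \<omega> \<tau>))"
proof -
  let ?G = "geometric_pmf (1 - disc D)"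
  have given: "prob_space (given D x)" "sets (given D x) = sets (scen D)"
    using given_prob_algebra[OF sm x] by (auto simp: space_prob_algebra)
  interpret S: prob_space "given D x" by (rule given(1))
  interpret P: pair_prob_space "measure_pmf ?G" "given D x" ..
  have "0 < 1 - disc D" "1 - disc D \<le> 1" using wc by (auto simp: weakly_coupled_def)
  then have "integrable ?G real"
    by (intro integrable_real_geometric_pmf) auto
  then have G: "integrable ?G (\<lambda>\<tau>. C * real (Suc \<tau>))"
    by (simp add: algebra_simps)
  have growth: "integrable (joint D x) (\<lambda>(\<omega>, \<tau>). C * real (Suc \<tau>))"
  proof -
    have "integrable (measure_pmf ?G \<Otimes>\<^sub>M given D x) (\<lambda>p. C * real (Suc (fst p)))"
      using G by (intro integrable_distr[OF measurable_fst]) (simp add: S.distr_pair_fst)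
    from P.integrable_product_swap[OF this] show ?thesis
      by (simp add: joint_def)
  qed
  have meas_joint: "(\<lambda>(\<omega>, \<tau>). real_of_ereal (f \<omega> \<tau>)) \<in> borel_measurable (joint D x)"
  proof -
    have 1: "(\<lambda>p. real_of_ereal (f (fst p) \<tau>)) \<in> borel_measurable (joint D x)" for \<tau>
    proof -
      have "(\<lambda>\<omega>. f \<omega> \<tau>) \<in> borel_measurable (given D x)"
        using meas measurable_cong_sets[OF given(2) refl] by blast
      then show ?thesis unfolding joint_def by measurable
    qed
    have 2: "snd \<in> joint D x \<rightarrow>\<^sub>M count_space UNIV"
      unfolding joint_def by measurable
    show ?thesis
      using measurable_compose_countable[OF 1 2] by (simp add: case_prod_beta')
  qed
  have "\<bar>real_of_ereal (f \<omega> \<tau>)\<bar> \<le> \<bar>C * real (Suc \<tau>)\<bar>" if "\<omega> \<in> space (scen D)" for \<omega> \<tau>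
    using bound[OF that, of \<tau>] by (cases "f \<omega> \<tau>") auto
  with growth meas_joint show ?thesis
    by (elim Bochner_Integration.integrable_bound) (auto simp: space_joint[OF sm x])
qed

section \<open>Nonpositive Bellman residuals\<close>

text \<open>Boundedness of the action values makes the supremum in the Bellman equation an upper
  bound of them.\<close>

lemma bellman_residual_nonpos:
  assumes wc: "weakly_coupled D" and h: "bounded_bellman_solution D l n h"
    and bdd: "bounded ((\<lambda>(x, a). rew D n x a - l \<bullet> con D n x a) ` space (graph D n))"
    and x: "x \<in> space (St D n)" and a: "a \<in> feas D n x"
  shows "rew D n x a - l \<bullet> con D n x a + disc D * (\<integral>y. h y \<partial>kern D n x a) \<le> h x"
proof -
  let ?q = "\<lambda>a. rew D n x a - l \<bullet> con D n x a + disc D * (\<integral>y. h y \<partial>kern D n x a)"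
  have \<beta>: "0 < disc D" "disc D < 1" using wc by (auto simp: weakly_coupled_def)
  obtain B where B: "\<And>x a. (x, a) \<in> space (graph D n) \<Longrightarrow> \<bar>rew D n x a - l \<bullet> con D n x a\<bar> \<le> B"
    using bdd by (fastforce simp: bounded_iff)
  obtain K where K: "\<And>z. z \<in> space (St D n) \<Longrightarrow> \<bar>h z\<bar> \<le> K"
    using h unfolding bounded_bellman_solution_def bounded_iff real_norm_def by blast
  have "?q a' \<le> B + K" if a': "a' \<in> feas D n x" for a'
  proof -
    interpret prob_space "kern D n x a'" by (rule prob_space_kern[OF wc x a'])
    have E: "\<bar>\<integral>y. h y \<partial>kern D n x a'\<bar> \<le> K"
      by (rule abs_expectation_le)
        (use K sets_eq_imp_space_eq[OF sets_kern[OF wc x a']] in auto)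
    have "\<bar>disc D * (\<integral>y. h y \<partial>kern D n x a')\<bar> \<le> 1 * K"
      unfolding abs_mult using \<beta> E by (intro mult_mono) auto
    with B[OF mem_space_graph[OF wc x a']] show ?thesis by (simp add: abs_le_iff)
  qed
  then have "bdd_above (?q ` feas D n x)" by (intro bdd_aboveI2)
  then have "?q a \<le> (SUP a\<in>feas D n x. ?q a)" by (rule cSUP_upper[OF a])
  with h x show ?thesis by (simp add: bounded_bellman_solution_def)
qed

text \<open>The expression is the sum of the Bellman residuals of the projects: both the linking
  functions and the expectation of \<open>J\<close> decouple across them, and the constant
  \<open>l \<bullet> budget D / (1 - disc D)\<close> of \<open>J\<close> is the one that absorbs the budget term.\<close>

lemma lagrangian_step_nonpos:
  assumes wc: "weakly_coupled D"
    and h: "\<And>n. bounded_bellman_solution D l n (h n)"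
    and bdd: "\<And>n. bounded ((\<lambda>(x, a). rew D n x a - l \<bullet> con D n x a) ` space (graph D n))"
    and J: "\<And>x. x \<in> space (states D) \<Longrightarrow>
      J x = l \<bullet> budget D / (1 - disc D) + (\<Sum>n\<in>UNIV. h n (x n))"
    and x: "x \<in> space (states D)" and a: "a \<in> act D x"
  shows "reward D x a + disc D * (\<integral>y. J y \<partial>trans D x a) - J x + l \<bullet> (budget D - linking D x a) \<le> 0"
proof -
  let ?E = "\<lambda>n. \<integral>z. h n z \<partial>kern D n (x n) (a n)" and ?c = "l \<bullet> budget D / (1 - disc D)"
  have EJ: "(\<integral>y. J y \<partial>trans D x a) = ?c + (\<Sum>n\<in>UNIV. ?E n)"
    by (rule expectation_separable[OF wc x a _ _ J])
      (use h in \<open>unfold bounded_bellman_solution_def, blast+\<close>)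
  have "disc D < 1" using wc by (auto simp: weakly_coupled_def)
  then have budget: "l \<bullet> budget D + disc D * ?c - ?c = 0"
    by (simp add: field_simps)
  have "reward D x a + disc D * (\<integral>y. J y \<partial>trans D x a) - J x + l \<bullet> (budget D - linking D x a)
    = (l \<bullet> budget D + disc D * ?c - ?c)
      + (\<Sum>n\<in>UNIV. rew D n (x n) (a n) - l \<bullet> con D n (x n) (a n) + disc D * ?E n - h n (x n))"
    unfolding EJ J[OF x]
    by (simp add: reward_def linking_def inner_diff_right inner_sum_right sum.distrib
        sum_subtractf sum_distrib_left algebra_simps)
  also have "\<dots> \<le> 0"
    unfolding budget
    using bellman_residual_nonpos[OF wc h bdd states_component[OF x] act_component[OF a]]
    by (simp add: sum_nonpos)
  finally show ?thesis .
qed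

lemma min_max_lagrangian_nonpos:
  assumes wc: "weakly_coupled D" and sm: "scenario_model D" and l: "0 \<le> l"
    and h: "\<And>n. bounded_bellman_solution D l n (h n)"
    and bdd: "\<And>n. bounded ((\<lambda>(x, a). rew D n x a - l \<bullet> con D n x a) ` space (graph D n))"
    and J: "\<And>x. x \<in> space (states D) \<Longrightarrow>
      J x = l \<bullet> budget D / (1 - disc D) + (\<Sum>n\<in>UNIV. h n (x n))"
    and \<omega>: "\<omega> \<in> space (scen D)"
  shows "min_max D J \<omega> \<tau> \<le> 0"
proof -
  have "min_max D J \<omega> \<tau> \<le> (SUP as\<in>paths D \<omega> \<tau>. ereal (info_value D J as \<omega> \<tau> (\<lambda>_. l)))"
    unfolding min_max_def by (rule INF_lower) (simp add: l)
  also have "\<dots> \<le> 0"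
  proof (rule SUP_least)
    fix as assume as: "as \<in> paths D \<omega> \<tau>"
    have "info_value D J as \<omega> \<tau> (\<lambda>_. l) \<le> 0"
      unfolding info_value_def Let_def
      by (rule sum_nonpos, rule lagrangian_step_nonpos[OF wc h bdd J])
        (use paths_state[OF sm \<omega> as] paths_act[OF as] in auto)
    then show "ereal (info_value D J as \<omega> \<tau> (\<lambda>_. l)) \<le> 0" by simp
  qed
  finally show ?thesis .
qed

section \<open>Comparison of the bounds\<close>

lemma L_op_le_L_circ_op:
  assumes wc: "weakly_coupled D" and sm: "scenario_model D" and H: "H \<in> separable D"
    and meas: "\<And>\<tau>. (\<lambda>\<omega>. max_feasible D H \<omega> \<tau>) \<in> borel_measurable (scen D)"
      "\<And>\<tau>. (\<lambda>\<omega>. min_max D H \<omega> \<tau>) \<in> borel_measurable (scen D)"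
    and x: "x \<in> space (states D)"
  shows "L_op D H x \<le> L_circ_op D H x"
proof -
  obtain C where C:
    "\<And>\<omega> \<tau>. \<omega> \<in> space (scen D) \<Longrightarrow> \<bar>max_feasible D H \<omega> \<tau>\<bar> \<le> ereal (C * real (Suc \<tau>))"
    "\<And>\<omega> \<tau>. \<omega> \<in> space (scen D) \<Longrightarrow> \<bar>min_max D H \<omega> \<tau>\<bar> \<le> ereal (C * real (Suc \<tau>))"
    using extremal_values_bounded[OF wc sm H] by blast
  have "(\<integral>(\<omega>, \<tau>). real_of_ereal (max_feasible D H \<omega> \<tau>) \<partial>joint D x)
      \<le> (\<integral>(\<omega>, \<tau>). real_of_ereal (min_max D H \<omega> \<tau>) \<partial>joint D x)"
  proof (rule integral_mono)
    show "integrable (joint D x) (\<lambda>(\<omega>, \<tau>). real_of_ereal (max_feasible D H \<omega> \<tau>))"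
      by (rule integrable_joint_linear_growth[OF wc sm x meas(1) C(1)])
    show "integrable (joint D x) (\<lambda>(\<omega>, \<tau>). real_of_ereal (min_max D H \<omega> \<tau>))"
      by (rule integrable_joint_linear_growth[OF wc sm x meas(2) C(2)])
    fix p assume p: "p \<in> space (joint D x)"
    obtain \<omega> \<tau> where [simp]: "p = (\<omega>, \<tau>)" by fastforce
    have \<omega>: "\<omega> \<in> space (scen D)" using p by (simp add: space_joint[OF sm x])
    \<comment> \<open>Finiteness matters here: \<open>real_of_ereal\<close> sends infinite values to \<open>0\<close>, so it is monotone
      on finite values but not on all extended reals.\<close>
    have "real_of_ereal (max_feasible D H \<omega> \<tau>) \<le> real_of_ereal (min_max D H \<omega> \<tau>)"
      using C(1)[OF \<omega>, of \<tau>] C(2)[OF \<omega>, of \<tau>] max_feasible_le_min_max[of D H \<omega> \<tau>]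
      by (cases "max_feasible D H \<omega> \<tau>"; cases "min_max D H \<omega> \<tau>") auto
    then show "(case p of (\<omega>, \<tau>) \<Rightarrow> real_of_ereal (max_feasible D H \<omega> \<tau>))
        \<le> (case p of (\<omega>, \<tau>) \<Rightarrow> real_of_ereal (min_max D H \<omega> \<tau>))"
      by simp
  qed
  then show ?thesis by (simp add: L_op_def L_circ_op_def)
qed

lemma L_circ_op_le:
  assumes "scenario_model D" "x \<in> space (states D)"
    and "\<And>\<omega> \<tau>. \<omega> \<in> space (scen D) \<Longrightarrow> min_max D H \<omega> \<tau> \<le> 0"
  shows "L_circ_op D H x \<le> H x"
proof -
  have "0 \<le> (\<integral>(\<omega>, \<tau>). - real_of_ereal (min_max D H \<omega> \<tau>) \<partial>joint D x)"
    using assms(3) by (intro Bochner_Integration.integral_nonneg)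
      (auto simp: space_joint[OF assms(1,2)] real_of_ereal_le_0)
  then show ?thesis by (simp add: L_circ_op_def case_prod_beta')
qed

theorem theorem5:
  fixes D :: "('n::finite, 'x, 'a, 'l::finite, 'w) wcdp"
  assumes "weakly_coupled D" and "scenario_model D"
  shows
    "(\<forall>H\<in>separable D.
        (\<forall>\<tau>. (\<lambda>\<omega>. max_feasible D H \<omega> \<tau>) \<in> borel_measurable (scen D)) \<longrightarrow>
        (\<forall>\<tau>. (\<lambda>\<omega>. min_max D H \<omega> \<tau>) \<in> borel_measurable (scen D)) \<longrightarrow>
        (\<forall>x\<in>space (states D). L_op D H x \<le> L_circ_op D H x))
     \<and>
     (\<forall>l h. 0 \<le> l \<longrightarrow>
        (\<forall>n. bounded ((\<lambda>(x, a). rew D n x a - l \<bullet> con D n x a) ` space (graph D n))) \<longrightarrow>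
        (\<forall>n. bounded_bellman_solution D l n (h n)) \<longrightarrow>
        (\<forall>x\<in>space (states D).
           lagrangian_bound D l x = l \<bullet> budget D / (1 - disc D) + (\<Sum>n\<in>UNIV. h n (x n))) \<longrightarrow>
        (\<forall>\<omega>\<in>space (scen D). \<forall>\<tau>. min_max D (lagrangian_bound D l) \<omega> \<tau> \<le> 0) \<and>
        ((\<forall>\<tau>. (\<lambda>\<omega>. min_max D (lagrangian_bound D l) \<omega> \<tau>) \<in> borel_measurable (scen D)) \<longrightarrow>
         (\<forall>x\<in>space (states D). L_circ_op D (lagrangian_bound D l) x \<le> lagrangian_bound D l x)))"
proof (intro conjI ballI allI impI, goal_cases)
  case (1 H x)
  then show ?case using L_op_le_L_circ_op[OF assms] by blast
next
  case (2 l h \<omega> \<tau>)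
  then show ?case by (intro min_max_lagrangian_nonpos[OF assms]) auto
next
  case (3 l h x)
  then show ?case
    by (intro L_circ_op_le[OF assms(2)] min_max_lagrangian_nonpos[OF assms]) auto
qed

end
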